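(* Let $\sigma\in\mathfrak{S}_n$, $1\le k<n$, and let $\zeta=\zeta(\sigma,k)$ be the element of maximal length of the coset $\sigma(\mathfrak{S}_k\times\mathfrak{S}_{n-k})$. If $K_\nu$ appears (with nonzero coefficient) in the expansion of $K_\omega\,\hat\pi_{\omega\zeta}\,\pi_{\zeta^{-1}\sigma}$ on the basis $K$, then for every $\nu'$ in the Bruhat interval $[\sigma,\nu]$, $K_{\nu'}$ also appears in this expansion.
   Context: Permutations are in one-line notation; $(\sigma\tau)(i)=\sigma(\tau(i))$; $s_i=(i,i+1)$; $\omega=[n,n-1,\dots,1]$; $\le$ is the (strong) Bruhat order. Consider the free $\mathbb{Z}$-module with basis of formal symbols $(K_\sigma)_{\sigma\in\mathfrak{S}_n}$. For $1\le i<n$ define right operators by $K_\sigma\pi_i=K_{\sigma s_i}$ if $\sigma(i)>\sigma(i+1)$ and $K_\sigma\pi_i=K_\sigma$ otherwise, and $\hat\pi_i=\pi_i-1$. Both families satisfy the braid relations, so for a reduced decomposition $\mu=s_{i_1}\cdots s_{i_m}$ one sets $\pi_\mu=\pi_{i_1}\cdots\pi_{i_m}$ and $\hat\pi_\mu=\hat\pi_{i_1}\cdots\hat\pi_{i_m}$ (applied from left to right). $\zeta$ is obtained from $\sigma$ by sorting the values in positions $1,\dots,k$ decreasingly and the values in positions $k+1,\dots,n$ decreasingly. *)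

theory Defs
  imports "HOL-Combinatorics.Permutations" "HOL-Library.Poly_Mapping"
begin

text \<open>
  The symmetric group on \<open>n\<close> letters consists of the functions \<open>\<sigma>\<close> with
  \<open>\<sigma> permutes {1..n}\<close>; the product \<open>\<sigma>\<tau>\<close> is \<open>\<sigma> \<circ> \<tau>\<close>.
\<close>

definition simple_refl :: "nat \<Rightarrow> nat \<Rightarrow> nat" where
  "simple_refl i = transpose i (Suc i)"

definition longest_perm :: "nat \<Rightarrow> nat \<Rightarrow> nat" where
  "longest_perm n = (\<lambda>i. if i \<in> {1..n} then n + 1 - i else i)"

definition word_prod :: "nat list \<Rightarrow> nat \<Rightarrow> nat" where
  "word_prod w = foldr (\<lambda>i \<tau>. simple_refl i \<circ> \<tau>) w id"

definition is_decomposition :: "nat \<Rightarrow> (nat \<Rightarrow> nat) \<Rightarrow> nat list \<Rightarrow> bool" where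
  "is_decomposition n \<mu> w \<longleftrightarrow> set w \<subseteq> {1..<n} \<and> word_prod w = \<mu>"

definition perm_length :: "nat \<Rightarrow> (nat \<Rightarrow> nat) \<Rightarrow> nat" where
  "perm_length n \<mu> = (LEAST m. \<exists>w. is_decomposition n \<mu> w \<and> length w = m)"

definition reduced_decomposition :: "nat \<Rightarrow> (nat \<Rightarrow> nat) \<Rightarrow> nat list \<Rightarrow> bool" where
  "reduced_decomposition n \<mu> w \<longleftrightarrow> is_decomposition n \<mu> w \<and> length w = perm_length n \<mu>"

definition bruhat_step :: "nat \<Rightarrow> (nat \<Rightarrow> nat) \<Rightarrow> (nat \<Rightarrow> nat) \<Rightarrow> bool" where
  "bruhat_step n \<sigma> \<tau> \<longleftrightarrow>
     (\<exists>a b. 1 \<le> a \<and> a < b \<and> b \<le> n \<and> \<tau> = \<sigma> \<circ> transpose a b \<and> perm_length n \<sigma> < perm_length n \<tau>)"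

definition bruhat_le :: "nat \<Rightarrow> (nat \<Rightarrow> nat) \<Rightarrow> (nat \<Rightarrow> nat) \<Rightarrow> bool" where
  "bruhat_le n \<sigma> \<tau> \<longleftrightarrow> \<sigma> permutes {1..n} \<and> \<tau> permutes {1..n} \<and> (bruhat_step n)\<^sup>*\<^sup>* \<sigma> \<tau>"

definition bruhat_interval :: "nat \<Rightarrow> (nat \<Rightarrow> nat) \<Rightarrow> (nat \<Rightarrow> nat) \<Rightarrow> (nat \<Rightarrow> nat) set" where
  "bruhat_interval n \<sigma> \<nu> = {\<tau>. bruhat_le n \<sigma> \<tau> \<and> bruhat_le n \<tau> \<nu>}"

text \<open>The left coset of \<open>\<sigma>\<close> modulo permutations of positions preserving
  \<open>{1..k}\<close> and \<open>{k+1..n}\<close>.\<close>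

definition young_coset :: "nat \<Rightarrow> nat \<Rightarrow> (nat \<Rightarrow> nat) \<Rightarrow> (nat \<Rightarrow> nat) set" where
  "young_coset n k \<sigma> =
     {\<sigma> \<circ> (\<alpha> \<circ> \<beta>) | \<alpha> \<beta>. \<alpha> permutes {1..k} \<and> \<beta> permutes {k+1..n}}"

text \<open>
  The symbol \<open>K\<^sub>\<sigma>\<close> is \<open>frag_of \<sigma>\<close>. The ambient free abelian group has a basis
  element for every function on \<open>nat\<close>; the module of the \<open>K\<^sub>\<sigma>\<close> with \<open>\<sigma> permutes {1..n}\<close> is a
  submodule, stable under the operators below for indices in \<open>{1..<n}\<close>.
\<close>

type_synonym kmod = "(nat \<Rightarrow> nat) \<Rightarrow>\<^sub>0 int"

definition pi_op :: "nat \<Rightarrow> kmod \<Rightarrow> kmod" where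
  "pi_op i = frag_extend (\<lambda>\<sigma>. frag_of (if \<sigma> i > \<sigma> (Suc i) then \<sigma> \<circ> simple_refl i else \<sigma>))"

definition pi_hat_op :: "nat \<Rightarrow> kmod \<Rightarrow> kmod" where
  "pi_hat_op i x = pi_op i x - x"

text \<open>
  Right operators: the first letter of the word acts first. The operator \<open>\<pi>\<^sub>\<mu>\<close> and
  its hatted analogue are obtained by taking for \<open>w\<close> any reduced decomposition of \<open>\<mu>\<close>.
\<close>

definition pi_word :: "nat list \<Rightarrow> kmod \<Rightarrow> kmod" where
  "pi_word w x = fold pi_op w x"

definition pi_hat_word :: "nat list \<Rightarrow> kmod \<Rightarrow> kmod" where
  "pi_hat_word w x = fold pi_hat_op w x"

end

(*
  Applying the hatted operators to K_omega gives the alternating sum of all K_nu with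
  nu >= zeta. Let J be the set of indices different from k and W_J = S_k x S_(n-k). Every lower
  Bruhat interval [id, nu] that meets a coset of W_J meets it in a set with a greatest element.
  Let I(sigma) be the set of those nu for which this greatest element, in the coset of sigma, is
  sigma itself; then I(zeta) consists of all nu >= zeta. If i is in J and sigma s_i < sigma, then
  pi_i maps the alternating sum over I(sigma) to the alternating sum over I(sigma s_i), because
  the terms of nu and nu s_i cancel when both lie in I(sigma). Hence I(sigma) is the support of
  the expansion, and by its definition it contains with nu the whole interval [sigma, nu].
*)

theory Submission
  imports Defs
begin

declare One_nat_def [simp del]

section \<open>Inversions and their change under right multiplication by a transposition\<close>

definition inversions :: "nat \<Rightarrow> (nat \<Rightarrow> nat) \<Rightarrow> (nat \<times> nat) set" where
  "inversions n \<sigma> = {(i, j). 1 \<le> i \<and> i < j \<and> j \<le> n \<and> \<sigma> j < \<sigma> i}"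

definition swap_pair :: "nat \<Rightarrow> nat \<Rightarrow> nat \<times> nat \<Rightarrow> nat \<times> nat" where
  "swap_pair a b = (\<lambda>(i, j). if transpose a b i < transpose a b j
     then (transpose a b i, transpose a b j) else (i, j))"

lemma finite_inversions [simp]: "finite (inversions n \<sigma>)"
  by (rule finite_subset[of _ "{1..n} \<times> {1..n}"]) (auto simp: inversions_def)

lemma card_inversions_le: "card (inversions n \<sigma>) \<le> n * n"
proof -
  have "card (inversions n \<sigma>) \<le> card ({1..n} \<times> {1..n})"
    by (rule card_mono) (auto simp: inversions_def)
  then show ?thesis by simp
qed

text \<open>A length-increasing transposition \<open>(a b)\<close> sends the inversions of \<open>\<sigma>\<close> injectively to
  those of \<open>\<sigma> \<circ> transpose a b\<close>, if pairs that it would put out of order stay unchanged.\<close>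

lemma swap_pair_swap_pair: "fst p < snd p \<Longrightarrow> swap_pair a b (swap_pair a b p) = p"
  by (cases p) (auto simp: swap_pair_def)

lemma inj_on_swap_pair: "inj_on (swap_pair a b) (inversions n \<sigma>)"
  by (rule inj_on_inverseI[where g = "swap_pair a b"])
    (auto simp: inversions_def swap_pair_swap_pair)

lemma swap_pair_inversions:
  assumes "1 \<le> a" "a < b" "b \<le> n" "\<sigma> a < \<sigma> b"
  shows "swap_pair a b ` inversions n \<sigma> \<subseteq> inversions n (\<sigma> \<circ> transpose a b) - {(a, b)}"
proof -
  have "swap_pair a b (i, j) \<in> inversions n (\<sigma> \<circ> transpose a b)"
    if "(i, j) \<in> inversions n \<sigma>" for i j
    using that assms
    by (cases "i = a"; cases "i = b"; cases "j = a"; cases "j = b")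
      (force simp: inversions_def swap_pair_def)+
  \<comment> \<open>\<open>swap_pair a b\<close> is an involution on ordered pairs and fixes (a, b),
    so only (a, b) itself could be sent there, and it is not an inversion of \<sigma>.\<close>
  moreover have "swap_pair a b (i, j) \<noteq> (a, b)" if "(i, j) \<in> inversions n \<sigma>" for i j
  proof
    assume eq: "swap_pair a b (i, j) = (a, b)"
    have "(i, j) = swap_pair a b (swap_pair a b (i, j))"
      using that by (subst swap_pair_swap_pair) (auto simp: inversions_def)
    also have "\<dots> = (a, b)" using assms by (simp add: eq) (simp add: swap_pair_def)
    finally show False using that assms by (simp add: inversions_def)
  qed
  ultimately show ?thesis by (intro image_subsetI) (metis DiffI prod.exhaust singletonD)
qed

lemma card_inversions_less:
  assumes "1 \<le> a" "a < b" "b \<le> n" "\<sigma> a < \<sigma> b"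
  shows "card (inversions n \<sigma>) < card (inversions n (\<sigma> \<circ> transpose a b))"
proof -
  have "card (inversions n \<sigma>) = card (swap_pair a b ` inversions n \<sigma>)"
    by (simp add: card_image inj_on_swap_pair)
  also have "\<dots> \<le> card (inversions n (\<sigma> \<circ> transpose a b) - {(a, b)})"
    by (rule card_mono) (simp_all add: swap_pair_inversions assms)
  also have "\<dots> < card (inversions n (\<sigma> \<circ> transpose a b))"
    by (rule card_Diff1_less[OF finite_inversions]) (use assms in \<open>auto simp: inversions_def\<close>)
  finally show ?thesis .
qed

text \<open>The only ordered pair of positions that s_i puts out of order is (i, i+1). The injection
  of inversions therefore misses just this pair, which makes the increase exactly one.\<close>

lemma card_inversions_simple_refl:
  assumes "1 \<le> i" "i < n" "\<sigma> i < \<sigma> (Suc i)"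
  shows "card (inversions n (\<sigma> \<circ> simple_refl i)) = Suc (card (inversions n \<sigma>))"
proof -
  have "inversions n (\<sigma> \<circ> simple_refl i) \<subseteq> insert (i, Suc i) (swap_pair i (Suc i) ` inversions n \<sigma>)"
  proof
    fix p assume p: "p \<in> inversions n (\<sigma> \<circ> simple_refl i)"
    obtain x y where xy: "p = (x, y)" by (cases p)
    show "p \<in> insert (i, Suc i) (swap_pair i (Suc i) ` inversions n \<sigma>)"
    proof (cases "p = (i, Suc i)")
      case False
      let ?t = "transpose i (Suc i)"
      have "(?t x, ?t y) \<in> inversions n \<sigma>" "?t x < ?t y"
        using p False assms unfolding xy simple_refl_def
        by (auto simp: inversions_def transpose_def split: if_splits)
      moreover have "p = swap_pair i (Suc i) (?t x, ?t y)"
        using p unfolding xy by (auto simp: swap_pair_def inversions_def)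
      ultimately show ?thesis by blast
    qed simp
  qed
  then have "card (inversions n (\<sigma> \<circ> simple_refl i))
      \<le> card (insert (i, Suc i) (swap_pair i (Suc i) ` inversions n \<sigma>))"
    by (intro card_mono) auto
  also have "\<dots> \<le> Suc (card (swap_pair i (Suc i) ` inversions n \<sigma>))"
    by (rule card_insert_le_m1) (auto simp: card_insert_if)
  also have "\<dots> = Suc (card (inversions n \<sigma>))"
    by (simp add: card_image inj_on_swap_pair)
  finally show ?thesis
    using card_inversions_less[of i "Suc i" n \<sigma>] assms by (simp add: simple_refl_def)
qed

lemma simple_refl_comp_self [simp]: "\<sigma> \<circ> simple_refl i \<circ> simple_refl i = \<sigma>"
  by (simp add: simple_refl_def comp_assoc)

lemma simple_refl_apply [simp]: "simple_refl i i = Suc i" "simple_refl i (Suc i) = i"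
  by (simp_all add: simple_refl_def)

lemma simple_refl_permutes: "1 \<le> i \<Longrightarrow> i < n \<Longrightarrow> simple_refl i permutes {1..n}"
  unfolding simple_refl_def by (rule permutes_swap_id) auto

lemma permutes_comp_simple_refl:
  "\<sigma> permutes {1..n} \<Longrightarrow> 1 \<le> i \<Longrightarrow> i < n \<Longrightarrow> \<sigma> \<circ> simple_refl i permutes {1..n}"
  by (rule permutes_compose[OF simple_refl_permutes])

lemma permutes_neq_Suc: "\<sigma> permutes S \<Longrightarrow> \<sigma> i \<noteq> \<sigma> (Suc i)"
  by (metis n_not_Suc_n permutes_inj inj_eq)

lemma card_inversions_simple_refl_le:
  assumes "\<sigma> permutes {1..n}" "1 \<le> i" "i < n"
  shows "card (inversions n (\<sigma> \<circ> simple_refl i)) \<le> Suc (card (inversions n \<sigma>))"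
proof (cases "\<sigma> i < \<sigma> (Suc i)")
  case False
  then have "(\<sigma> \<circ> simple_refl i) i < (\<sigma> \<circ> simple_refl i) (Suc i)"
    using permutes_neq_Suc[OF assms(1), of i] by simp
  from card_inversions_simple_refl[of i n "\<sigma> \<circ> simple_refl i", OF assms(2,3) this]
  show ?thesis by simp
qed (simp add: card_inversions_simple_refl[OF assms(2,3)])

text \<open>Injectivity makes the increase strict, so \<open>i \<le> \<sigma> i\<close> follows by
  induction, and a permutation that lowers no number is the identity. This ends the inductions that
  remove descents one at a time.\<close>

lemma permutes_no_descent_eq_id:
  assumes "\<sigma> permutes {1..n}" and asc: "\<And>i. 1 \<le> i \<Longrightarrow> i < n \<Longrightarrow> \<sigma> i \<le> \<sigma> (Suc i)"
  shows "\<sigma> = id"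
proof -
  have "1 \<le> i \<longrightarrow> i \<le> n \<longrightarrow> i \<le> \<sigma> i" for i
  proof (induction i)
    case (Suc i)
    show ?case
    proof (cases "i = 0")
      case True
      then show ?thesis using permutes_in_image[OF assms(1), of 1] by (auto simp: One_nat_def)
    next
      case False
      then show ?thesis
        using Suc asc[of i] permutes_neq_Suc[OF assms(1), of i] by force
    qed
  qed simp
  then show ?thesis using assms(1) permutes_natset_ge[of \<sigma> "{1..n}"] by auto
qed

section \<open>Words, reduced decompositions and length\<close>

lemma word_prod_Nil [simp]: "word_prod [] = id"
  by (simp add: word_prod_def)

lemma word_prod_Cons: "word_prod (i # w) = simple_refl i \<circ> word_prod w"
  by (simp add: word_prod_def)

lemma word_prod_snoc: "word_prod (w @ [i]) = word_prod w \<circ> simple_refl i"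
  by (induction w) (simp_all add: word_prod_Cons comp_assoc)

lemma word_prod_permutes: "set w \<subseteq> {1..<n} \<Longrightarrow> word_prod w permutes {1..n}"
proof (induction w rule: rev_induct)
  case (snoc i w)
  then show ?case unfolding word_prod_snoc by (intro permutes_comp_simple_refl) auto
qed (simp add: permutes_id)

lemma inversions_id [simp]: "inversions n id = {}"
  by (auto simp: inversions_def)

lemma card_inversions_word_prod:
  "set w \<subseteq> {1..<n} \<Longrightarrow> card (inversions n (word_prod w)) \<le> length w"
proof (induction w rule: rev_induct)
  case (snoc i w)
  have "card (inversions n (word_prod (w @ [i]))) \<le> Suc (card (inversions n (word_prod w)))"
    unfolding word_prod_snoc
    by (rule card_inversions_simple_refl_le) (use snoc in \<open>auto intro: word_prod_permutes\<close>)
  then show ?case using snoc by simp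
qed simp

text \<open>Cancelling a descent on the right lowers the inversion number by one, and the process
  can stop only at the identity.\<close>

lemma ex_decomposition:
  assumes "\<sigma> permutes {1..n}"
  shows "\<exists>w. is_decomposition n \<sigma> w \<and> length w = card (inversions n \<sigma>)"
  using assms
proof (induction "card (inversions n \<sigma>)" arbitrary: \<sigma> rule: less_induct)
  case less
  show ?case
  proof (cases "\<exists>i. 1 \<le> i \<and> i < n \<and> \<sigma> (Suc i) < \<sigma> i")
    case True
    then obtain i where i: "1 \<le> i" "i < n" "\<sigma> (Suc i) < \<sigma> i" by blast
    then have card: "card (inversions n \<sigma>) = Suc (card (inversions n (\<sigma> \<circ> simple_refl i)))"
      using card_inversions_simple_refl[of i n "\<sigma> \<circ> simple_refl i"] by simp
    then obtain w where "is_decomposition n (\<sigma> \<circ> simple_refl i) w"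
        "length w = card (inversions n (\<sigma> \<circ> simple_refl i))"
      using less i permutes_comp_simple_refl by (metis lessI)
    then have "is_decomposition n \<sigma> (w @ [i]) \<and> length (w @ [i]) = card (inversions n \<sigma>)"
      using card i by (simp add: is_decomposition_def word_prod_snoc)
    then show ?thesis by blast
  next
    case False
    then have "\<sigma> = id" using less.prems permutes_no_descent_eq_id by (meson not_le_imp_less)
    then show ?thesis by (simp add: is_decomposition_def)
  qed
qed

lemma perm_length_eq_card_inversions:
  assumes "\<sigma> permutes {1..n}"
  shows "perm_length n \<sigma> = card (inversions n \<sigma>)"
  unfolding perm_length_def
proof (rule Least_equality)
  show "\<exists>w. is_decomposition n \<sigma> w \<and> length w = card (inversions n \<sigma>)"
    by (rule ex_decomposition[OF assms])
qed (auto simp: is_decomposition_def card_inversions_word_prod)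

lemma reduced_decomposition_iff:
  "reduced_decomposition n \<mu> w \<longleftrightarrow>
     set w \<subseteq> {1..<n} \<and> word_prod w = \<mu> \<and> length w = card (inversions n \<mu>)"
  using perm_length_eq_card_inversions word_prod_permutes
  by (auto simp: reduced_decomposition_def is_decomposition_def)

text \<open>A letter adds at most one inversion, so a word with as many letters as its product has
  inversions must gain one with every letter. This drives all inductions along reduced
  words.\<close>

lemma reduced_decomposition_snoc:
  assumes "reduced_decomposition n \<mu> (w @ [i])"
  shows "reduced_decomposition n (word_prod w) w" "\<mu> = word_prod w \<circ> simple_refl i"
    "1 \<le> i" "i < n" "word_prod w i < word_prod w (Suc i)"
proof -
  let ?p = "word_prod w"
  have w: "set w \<subseteq> {1..<n}" and \<mu>: "\<mu> = ?p \<circ> simple_refl i"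
    and len: "Suc (length w) = card (inversions n \<mu>)" and i: "1 \<le> i" "i < n"
    using assms by (auto simp: reduced_decomposition_iff word_prod_snoc)
  have p: "?p permutes {1..n}" by (rule word_prod_permutes[OF w])
  have le: "card (inversions n ?p) \<le> length w" by (rule card_inversions_word_prod[OF w])
  have "card (inversions n \<mu>) \<le> Suc (card (inversions n ?p))"
    unfolding \<mu> by (rule card_inversions_simple_refl_le[OF p i])
  with le len w show "reduced_decomposition n ?p w" by (simp add: reduced_decomposition_iff)
  show "?p i < ?p (Suc i)"
  proof (rule ccontr)
    assume "\<not> ?p i < ?p (Suc i)"
    then have "\<mu> i < \<mu> (Suc i)"
      using permutes_neq_Suc[OF p, of i] unfolding \<mu> by simp
    from card_inversions_simple_refl[of i n \<mu>, OF i this] show False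
      using le len by (simp add: \<mu>)
  qed
qed (use assms in \<open>auto simp: reduced_decomposition_iff word_prod_snoc\<close>)

section \<open>The Bruhat order through comparison of values, and its invariance under
  inversion\<close>

text \<open>One of \<sigma> and \<sigma>(a b) has the smaller value at a, and
  \<open>card_inversions_less\<close> applied to that one decides which is longer.\<close>

lemma bruhat_step_iff:
  assumes "\<sigma> permutes {1..n}"
  shows "bruhat_step n \<sigma> \<tau> \<longleftrightarrow>
    (\<exists>a b. 1 \<le> a \<and> a < b \<and> b \<le> n \<and> \<tau> = \<sigma> \<circ> transpose a b \<and> \<sigma> a < \<sigma> b)"
proof -
  have "perm_length n \<sigma> < perm_length n (\<sigma> \<circ> transpose a b) \<longleftrightarrow> \<sigma> a < \<sigma> b"
    if ab: "1 \<le> a" "a < b" "b \<le> n" for a b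
  proof -
    have perm: "\<sigma> \<circ> transpose a b permutes {1..n}"
      by (rule permutes_compose[OF permutes_swap_id assms]) (use ab in auto)
    have "\<sigma> a \<noteq> \<sigma> b" using assms ab by (metis nat_neq_iff permutes_inj inj_eq)
    then show ?thesis
      using card_inversions_less[OF ab, of \<sigma>] card_inversions_less[OF ab, of "\<sigma> \<circ> transpose a b"]
      by (cases "\<sigma> a < \<sigma> b")
        (auto simp: perm_length_eq_card_inversions perm assms comp_assoc)
  qed
  then show ?thesis unfolding bruhat_step_def by blast
qed

lemma bruhat_step_permutes:
  assumes "\<sigma> permutes {1..n}" "bruhat_step n \<sigma> \<tau>"
  shows "\<tau> permutes {1..n}"
proof -
  obtain a b where "1 \<le> a" "a < b" "b \<le> n" "\<tau> = \<sigma> \<circ> transpose a b"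
    using assms(2) by (auto simp: bruhat_step_def)
  then show ?thesis using permutes_compose[OF permutes_swap_id assms(1)] by auto
qed

lemma bruhat_steps_permutes:
  "(bruhat_step n)\<^sup>*\<^sup>* \<sigma> \<tau> \<Longrightarrow> \<sigma> permutes {1..n} \<Longrightarrow> \<tau> permutes {1..n}"
  by (induction rule: rtranclp_induct) (auto intro: bruhat_step_permutes)

lemma bruhat_le_refl: "\<sigma> permutes {1..n} \<Longrightarrow> bruhat_le n \<sigma> \<sigma>"
  by (simp add: bruhat_le_def)

lemma bruhat_le_trans: "bruhat_le n \<sigma> \<tau> \<Longrightarrow> bruhat_le n \<tau> \<nu> \<Longrightarrow> bruhat_le n \<sigma> \<nu>"
  by (auto simp: bruhat_le_def)

lemma bruhat_le_permutes:
  "bruhat_le n \<sigma> \<tau> \<Longrightarrow> \<sigma> permutes {1..n}" "bruhat_le n \<sigma> \<tau> \<Longrightarrow> \<tau> permutes {1..n}"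
  by (auto simp: bruhat_le_def)

lemma bruhat_step_imp_le:
  "bruhat_step n \<sigma> \<tau> \<Longrightarrow> \<sigma> permutes {1..n} \<Longrightarrow> bruhat_le n \<sigma> \<tau>"
  using bruhat_step_permutes by (auto simp: bruhat_le_def)

lemma bruhat_le_induct [consumes 1, case_names refl step]:
  assumes "bruhat_le n \<sigma> \<tau>" "P \<sigma>"
    and "\<And>\<tau> \<tau>'. bruhat_le n \<sigma> \<tau> \<Longrightarrow> bruhat_step n \<tau> \<tau>' \<Longrightarrow> P \<tau> \<Longrightarrow> P \<tau>'"
  shows "P \<tau>"
proof -
  have \<sigma>: "\<sigma> permutes {1..n}" and "(bruhat_step n)\<^sup>*\<^sup>* \<sigma> \<tau>" using assms(1) by (auto simp: bruhat_le_def)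
  from this(2) show ?thesis
  proof (induction rule: rtranclp_induct)
    case (step \<tau> \<tau>')
    moreover have "bruhat_le n \<sigma> \<tau>"
      using step \<sigma> bruhat_steps_permutes by (auto simp: bruhat_le_def)
    ultimately show ?case using assms(3) by blast
  qed (rule assms(2))
qed

lemma bruhat_le_eq_or_length_less:
  assumes "bruhat_le n \<sigma> \<tau>"
  shows "\<sigma> = \<tau> \<or> perm_length n \<sigma> < perm_length n \<tau>"
  using assms by (induction rule: bruhat_le_induct) (auto simp: bruhat_step_def)

lemma bruhat_le_antisym: "bruhat_le n \<sigma> \<tau> \<Longrightarrow> bruhat_le n \<tau> \<sigma> \<Longrightarrow> \<sigma> = \<tau>"
  by (metis bruhat_le_eq_or_length_less order_less_asym)

text \<open>Conjugation moves (a b) past the inverse of \<tau>, where it becomes the transposition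
  of \<open>\<tau> a\<close> and \<open>\<tau> b\<close>. Positions and values exchange roles:
  \<open>\<tau> a < \<tau> b\<close> now orders the positions and \<open>a < b\<close> the
  values.\<close>

lemma bruhat_le_inv:
  assumes "bruhat_le n \<sigma> \<tau>"
  shows "bruhat_le n (inv \<sigma>) (inv \<tau>)"
  using assms
proof (induction rule: bruhat_le_induct)
  case refl
  show ?case using bruhat_le_permutes(1)[OF assms] by (intro bruhat_le_refl permutes_inv)
next
  case (step \<tau> \<tau>')
  then have \<tau>: "\<tau> permutes {1..n}" by (simp add: bruhat_le_permutes)
  obtain a b where ab: "1 \<le> a" "a < b" "b \<le> n" "\<tau>' = \<tau> \<circ> transpose a b" "\<tau> a < \<tau> b"
    using step(2) by (auto simp: bruhat_step_iff[OF \<tau>])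
  have "inv \<tau>' = transpose a b \<circ> inv \<tau>"
    using ab(4) \<tau> by (simp add: o_inv_distrib permutes_bij)
  also have "\<dots> = inv \<tau> \<circ> transpose (\<tau> a) (\<tau> b)"
    using \<tau> by (auto simp: fun_eq_iff transpose_def permutes_inverses permutes_inv_eq)
  finally have eq: "inv \<tau>' = inv \<tau> \<circ> transpose (\<tau> a) (\<tau> b)" .
  have "bruhat_step n (inv \<tau>) (inv \<tau>')"
    unfolding bruhat_step_iff[OF permutes_inv[OF \<tau>]]
    using eq ab permutes_in_image[OF \<tau>, of a] permutes_in_image[OF \<tau>, of b]
    by (intro exI[of _ "\<tau> a"] exI[of _ "\<tau> b"]) (auto simp: permutes_inverses[OF \<tau>])
  then show ?case
    using step.IH bruhat_step_imp_le permutes_inv[OF \<tau>] bruhat_le_trans by blast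
qed

section \<open>Projections to the ends of the coset {\<sigma>, \<sigma> s_i}, and the lifting
  property\<close>

text \<open>For permutations, \<open>low i\<close> and \<open>high i\<close> pick the lower and the
  upper end of the coset {\<sigma>, \<sigma> s_i}; \<open>low i\<close> is also the action of
  \<pi>_i on the basis symbols.\<close>

definition low :: "nat \<Rightarrow> (nat \<Rightarrow> nat) \<Rightarrow> (nat \<Rightarrow> nat)" where
  "low i \<sigma> = (if \<sigma> (Suc i) < \<sigma> i then \<sigma> \<circ> simple_refl i else \<sigma>)"

definition high :: "nat \<Rightarrow> (nat \<Rightarrow> nat) \<Rightarrow> (nat \<Rightarrow> nat)" where
  "high i \<sigma> = (if \<sigma> i < \<sigma> (Suc i) then \<sigma> \<circ> simple_refl i else \<sigma>)"

lemma bruhat_le_simple_refl: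
  assumes "\<sigma> permutes {1..n}" "1 \<le> i" "i < n" "\<sigma> i < \<sigma> (Suc i)"
  shows "bruhat_le n \<sigma> (\<sigma> \<circ> simple_refl i)"
proof (rule bruhat_step_imp_le)
  show "bruhat_step n \<sigma> (\<sigma> \<circ> simple_refl i)"
    unfolding bruhat_step_iff[OF assms(1)] simple_refl_def
    by (intro exI[of _ i] exI[of _ "Suc i"]) (use assms in auto)
qed (rule assms)

lemma le_high: "\<sigma> permutes {1..n} \<Longrightarrow> 1 \<le> i \<Longrightarrow> i < n \<Longrightarrow> bruhat_le n \<sigma> (high i \<sigma>)"
  by (auto simp: high_def bruhat_le_refl bruhat_le_simple_refl)

lemma low_le:
  assumes "\<sigma> permutes {1..n}" "1 \<le> i" "i < n"
  shows "bruhat_le n (low i \<sigma>) \<sigma>"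
  using bruhat_le_simple_refl[of "\<sigma> \<circ> simple_refl i" n i] assms
  by (auto simp: low_def bruhat_le_refl permutes_comp_simple_refl)

text \<open>Conjugation by s_i moves a and b to their images under s_i and compares the same two
  values; it keeps the positions in order unless a = i and b = i + 1.\<close>

lemma bruhat_step_simple_refl:
  assumes "\<sigma> permutes {1..n}" "bruhat_step n \<sigma> \<tau>" "1 \<le> i" "i < n"
  shows "\<tau> = \<sigma> \<circ> simple_refl i \<or> bruhat_step n (\<sigma> \<circ> simple_refl i) (\<tau> \<circ> simple_refl i)"
proof -
  let ?s = "simple_refl i"
  obtain a b where ab: "1 \<le> a" "a < b" "b \<le> n" "\<tau> = \<sigma> \<circ> transpose a b" "\<sigma> a < \<sigma> b"
    using assms(2) by (auto simp: bruhat_step_iff[OF assms(1)])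
  show ?thesis
  proof (cases "a = i \<and> b = Suc i")
    case True
    then show ?thesis using ab by (simp add: simple_refl_def)
  next
    case False
    then have "?s a < ?s b" "1 \<le> ?s a" "?s b \<le> n"
      using ab assms(3,4) by (auto simp: simple_refl_def transpose_def)
    moreover have "\<tau> \<circ> ?s = \<sigma> \<circ> ?s \<circ> transpose (?s a) (?s b)"
      unfolding ab(4) simple_refl_def by (auto simp: fun_eq_iff transpose_def)
    moreover have "(\<sigma> \<circ> ?s) (?s a) < (\<sigma> \<circ> ?s) (?s b)"
      using ab(5) by (simp add: simple_refl_def)
    ultimately show ?thesis
      using bruhat_step_iff[OF permutes_comp_simple_refl[OF assms(1,3,4)]] by blast
  qed
qed

text \<open>This is the lifting property in monotone form. In each step either both ends lie in one
  coset of s_i, and the projections agree, or the step persists after right multiplication by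
  s_i.\<close>

lemma bruhat_le_low_high:
  assumes "bruhat_le n \<sigma> \<tau>" "1 \<le> i" "i < n"
  shows "bruhat_le n (low i \<sigma>) (low i \<tau>) \<and> bruhat_le n (high i \<sigma>) (high i \<tau>)"
  using assms(1)
proof (induction rule: bruhat_le_induct)
  case refl
  have "\<sigma> permutes {1..n}" using assms(1) by (rule bruhat_le_permutes)
  then show ?case
    using permutes_comp_simple_refl[OF _ assms(2,3)]
    by (simp add: low_def high_def bruhat_le_refl)
next
  case (step \<tau> \<tau>')
  let ?s = "simple_refl i"
  have \<tau>: "\<tau> permutes {1..n}" using step bruhat_le_permutes by blast
  have \<tau>': "\<tau>' permutes {1..n}" using step \<tau> bruhat_step_permutes by blast
  have le: "bruhat_le n \<tau> \<tau>'" using step \<tau> bruhat_step_imp_le by blast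
  have "bruhat_le n (low i \<tau>) (low i \<tau>') \<and> bruhat_le n (high i \<tau>) (high i \<tau>')"
    using bruhat_step_simple_refl[OF \<tau> step(2) assms(2,3)]
  proof
    assume eq: "\<tau>' = \<tau> \<circ> ?s"
    have "low i \<tau>' = low i \<tau>" "high i \<tau>' = high i \<tau>"
      using permutes_neq_Suc[OF \<tau>, of i] by (auto simp: low_def high_def eq)
    then show ?thesis
      using \<tau> permutes_comp_simple_refl[OF _ assms(2,3)]
      by (simp add: low_def high_def bruhat_le_refl)
  next
    assume "bruhat_step n (\<tau> \<circ> ?s) (\<tau>' \<circ> ?s)"
    then have les: "bruhat_le n (\<tau> \<circ> ?s) (\<tau>' \<circ> ?s)"
      using bruhat_step_imp_le permutes_comp_simple_refl \<tau> assms by blast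
    \<comment> \<open>With \<tau> \<le> \<tau>' and \<tau> s_i \<le> \<tau>' s_i at hand, each
      combination of ascents and descents at i is settled by a chain through these relations and the
      coset ends.\<close>
    show ?thesis
      using le les low_le[OF \<tau> assms(2,3)] low_le[OF \<tau>' assms(2,3)]
        le_high[OF \<tau> assms(2,3)] le_high[OF \<tau>' assms(2,3)]
        permutes_neq_Suc[OF \<tau>, of i] permutes_neq_Suc[OF \<tau>', of i]
      by (auto simp: low_def high_def split: if_splits intro: bruhat_le_trans
          dest: bruhat_le_simple_refl[OF \<tau> assms(2,3)] bruhat_le_simple_refl[OF \<tau>' assms(2,3)])
  qed
  then show ?case using step.IH bruhat_le_trans by blast
qed

lemmas bruhat_le_low = bruhat_le_low_high[THEN conjunct1]
lemmas bruhat_le_high = bruhat_le_low_high[THEN conjunct2]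

section \<open>Young cosets and their greatest elements below a given permutation\<close>

lemma simple_refl_image_atMost: "i \<noteq> k \<Longrightarrow> simple_refl i ` {..k} = {..k}"
  unfolding simple_refl_def by (rule transpose_image_eq) auto

text \<open>From here on a coset of W_J is recorded by the image of \<open>{..k}\<close>: the values
  in the first k positions, together with 0, which permutations of {1..n} fix.\<close>

lemma coset_simple_refl: "i \<noteq> k \<Longrightarrow> (\<tau> \<circ> simple_refl i) ` {..k} = \<tau> ` {..k}"
  by (metis image_comp simple_refl_image_atMost)

lemma coset_low: "i \<noteq> k \<Longrightarrow> low i \<tau> ` {..k} = \<tau> ` {..k}"
  by (metis low_def coset_simple_refl)

text \<open>Stated for the inverses, so that the induction, which uses left descents of the
  original permutations, needs only right multiplication.\<close>

lemma ex_max_vimage: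
  assumes "bruhat_le n \<rho>\<^sub>0 \<nu>" "\<rho>\<^sub>0 -` {..k} = A"
  shows "\<exists>m. bruhat_le n m \<nu> \<and> m -` {..k} = A \<and>
    (\<forall>\<rho>. bruhat_le n \<rho> \<nu> \<and> \<rho> -` {..k} = A \<longrightarrow> bruhat_le n \<rho> m)"
  using assms
\<comment> \<open>The induction passes from \<nu> to \<nu> s_i at a descent i. The set
  \<open>A\<close> stays general because it may be replaced by its image under s_i.\<close>
proof (induction "card (inversions n \<nu>)" arbitrary: \<nu> \<rho>\<^sub>0 A rule: less_induct)
  case less
  have \<nu>: "\<nu> permutes {1..n}" using less.prems bruhat_le_permutes by blast
  show ?case
  proof (cases "\<exists>i. 1 \<le> i \<and> i < n \<and> \<nu> (Suc i) < \<nu> i")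
    case False
    then have "\<nu> = id" using \<nu> permutes_no_descent_eq_id by (meson not_le_imp_less)
    then have "\<rho> = \<nu>" if "bruhat_le n \<rho> \<nu>" for \<rho>
      using bruhat_le_eq_or_length_less[OF that] perm_length_eq_card_inversions[OF \<nu>] by auto
    then show ?thesis using less.prems bruhat_le_refl[OF \<nu>] by metis
  next
    case True
    then obtain i where i: "1 \<le> i" "i < n" and desc: "\<nu> (Suc i) < \<nu> i" by blast
    let ?s = "simple_refl i"
    let ?\<nu> = "\<nu> \<circ> ?s"
    have low: "low i \<nu> = ?\<nu>" and high: "high i ?\<nu> = \<nu>" and high': "high i \<nu> = \<nu>"
      using desc by (simp_all add: low_def high_def)
    have less': "card (inversions n ?\<nu>) < card (inversions n \<nu>)"
      using card_inversions_simple_refl[of i n ?\<nu>] i desc by simp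
    have le: "bruhat_le n ?\<nu> \<nu>" using low_le[OF \<nu> i] low by simp
    have down: "bruhat_le n (low i \<rho>) ?\<nu>" if "bruhat_le n \<rho> \<nu>" for \<rho>
      using bruhat_le_low[OF that i] low by simp
    have up: "bruhat_le n (high i \<rho>) \<nu>" if "bruhat_le n \<rho> ?\<nu>" for \<rho>
      using bruhat_le_high[OF that i] high by simp
    have vimage: "(\<rho> \<circ> ?s) -` {..k} = ?s -` (\<rho> -` {..k})" for \<rho> :: "nat \<Rightarrow> nat"
      by (simp add: vimage_comp)
    consider "i \<in> A \<longleftrightarrow> Suc i \<in> A" | "i \<in> A" "Suc i \<notin> A" | "i \<notin> A" "Suc i \<in> A" by blast
    then show ?thesis
    proof cases
      \<comment> \<open>Here s_i preserves \<open>A\<close>, so both projections respect the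
        constraint. A candidate is pushed below \<nu> s_i by \<open>low i\<close>, bounded there by
        \<open>m\<close>, and lifted back by \<open>high i\<close>.\<close>
      case 1
      then have "?s -` A = A" by (auto simp: simple_refl_def transpose_def split: if_splits)
      then have stable: "low i \<rho> -` {..k} = A" "high i \<rho> -` {..k} = A" if "\<rho> -` {..k} = A" for \<rho>
        using that vimage by (simp_all add: low_def high_def)
      obtain m where m: "bruhat_le n m ?\<nu>" "m -` {..k} = A"
        and max: "\<And>\<rho>. bruhat_le n \<rho> ?\<nu> \<Longrightarrow> \<rho> -` {..k} = A \<Longrightarrow> bruhat_le n \<rho> m"
        using less.hyps[OF less' down[OF less.prems(1)] stable(1)[OF less.prems(2)]] by blast
      have "bruhat_le n \<rho> (high i m)" if "bruhat_le n \<rho> \<nu>" "\<rho> -` {..k} = A" for \<rho>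
      proof -
        have \<rho>: "\<rho> permutes {1..n}" using that bruhat_le_permutes by blast
        have "bruhat_le n (low i \<rho>) m" by (rule max[OF down[OF that(1)] stable(1)[OF that(2)]])
        then have "bruhat_le n (high i (low i \<rho>)) (high i m)" by (rule bruhat_le_high[OF _ i])
        moreover have "high i (low i \<rho>) = high i \<rho>"
          using permutes_neq_Suc[OF \<rho>, of i] by (simp add: high_def low_def)
        ultimately show ?thesis using bruhat_le_trans[OF le_high[OF \<rho> i]] by simp
      qed
      then show ?thesis using up[OF m(1)] stable(2)[OF m(2)] by blast
    next
      \<comment> \<open>Here \<rho>(i) \<le> k < \<rho>(i+1) for every candidate: an ascent, so
        \<open>low i\<close> fixes \<rho>, which thus already lies below \<nu> s_i.\<close>
      case 2
      have fixed: "low i \<rho> = \<rho>" if "\<rho> -` {..k} = A" for \<rho>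
        using 2 that by (auto simp: low_def)
      obtain m where "bruhat_le n m ?\<nu>" "m -` {..k} = A"
        "\<forall>\<rho>. bruhat_le n \<rho> ?\<nu> \<and> \<rho> -` {..k} = A \<longrightarrow> bruhat_le n \<rho> m"
        using less.hyps[OF less' _ less.prems(2)] down[OF less.prems(1)]
        unfolding fixed[OF less.prems(2)] by blast
      moreover have "bruhat_le n \<rho> ?\<nu>" if "bruhat_le n \<rho> \<nu>" "\<rho> -` {..k} = A" for \<rho>
        using down[OF that(1)] unfolding fixed[OF that(2)] .
      ultimately show ?thesis using bruhat_le_trans[OF _ le] by blast
    next
      \<comment> \<open>Here \<rho>(i+1) \<le> k < \<rho>(i) for every candidate: a descent, so
        \<open>low i\<close> multiplies by s_i and moves the constraint to the image of
        \<open>A\<close>. On that side \<open>high i\<close> undoes this.\<close>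
      case 3
      have lower: "low i \<rho> = \<rho> \<circ> ?s" "low i \<rho> -` {..k} = ?s -` A" if "\<rho> -` {..k} = A" for \<rho>
      proof -
        show "low i \<rho> = \<rho> \<circ> ?s" using 3 that by (auto simp: low_def)
        then show "low i \<rho> -` {..k} = ?s -` A" using that vimage by simp
      qed
      obtain m where m: "bruhat_le n m ?\<nu>" "m -` {..k} = ?s -` A"
        and max: "\<And>\<rho>. bruhat_le n \<rho> ?\<nu> \<Longrightarrow> \<rho> -` {..k} = ?s -` A \<Longrightarrow> bruhat_le n \<rho> m"
        using less.hyps[OF less' down[OF less.prems(1)] lower(2)[OF less.prems(2)]] by blast
      have upper: "high i \<rho> = \<rho> \<circ> ?s" if "\<rho> -` {..k} = ?s -` A" for \<rho>
      proof -
        have "i \<in> \<rho> -` {..k}" "Suc i \<notin> \<rho> -` {..k}" using 3 unfolding that by auto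
        then show ?thesis by (auto simp: high_def)
      qed
      have "bruhat_le n \<rho> (high i m)" if "bruhat_le n \<rho> \<nu>" "\<rho> -` {..k} = A" for \<rho>
      proof -
        have "high i (low i \<rho>) = low i \<rho> \<circ> ?s" by (rule upper[OF lower(2)[OF that(2)]])
        also have "\<dots> = \<rho>" by (simp add: lower(1)[OF that(2)])
        finally show ?thesis
          using bruhat_le_high[OF max[OF down[OF that(1)] lower(2)[OF that(2)]] i] by simp
      qed
      moreover have "high i m -` {..k} = A"
      proof -
        have "high i m -` {..k} = ?s -` ?s -` A" by (simp only: upper[OF m(2)] vimage m(2))
        then show ?thesis by (simp add: vimage_comp[symmetric] simple_refl_def vimage_def)
      qed
      ultimately show ?thesis using up[OF m(1)] by blast
    qed
  qed
qed

text \<open>Inversion preserves the order and turns preimages of \<open>{..k}\<close> into images,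
  so \<open>ex_max_vimage\<close> applies to the inverses.\<close>

lemma ex_coset_max:
  assumes "bruhat_le n \<sigma> \<nu>"
  shows "\<exists>m. bruhat_le n m \<nu> \<and> m ` {..k} = \<sigma> ` {..k} \<and>
    (\<forall>\<tau>. bruhat_le n \<tau> \<nu> \<and> \<tau> ` {..k} = \<sigma> ` {..k} \<longrightarrow> bruhat_le n \<tau> m)"
proof -
  have img: "inv \<tau> -` {..k} = \<tau> ` {..k}" if "\<tau> permutes {1..n}" for \<tau>
    using bij_vimage_eq_inv_image[OF bij_imp_bij_inv[OF permutes_bij[OF that]]]
    by (simp add: inv_inv_eq permutes_bij[OF that])
  have inv_inv: "inv (inv \<tau>) = \<tau>" if "\<tau> permutes {1..n}" for \<tau>
    using that by (simp add: inv_inv_eq permutes_bij)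
  have inv_le: "bruhat_le n (inv \<tau>) \<rho>" if "bruhat_le n \<tau> (inv \<rho>)" "\<rho> permutes {1..n}" for \<tau> \<rho>
    using bruhat_le_inv[OF that(1)] inv_inv[OF that(2)] by simp
  note p = bruhat_le_permutes[OF assms]
  obtain m where m: "bruhat_le n m (inv \<nu>)" "m -` {..k} = \<sigma> ` {..k}"
    and max: "\<And>\<rho>. bruhat_le n \<rho> (inv \<nu>) \<Longrightarrow> \<rho> -` {..k} = \<sigma> ` {..k} \<Longrightarrow> bruhat_le n \<rho> m"
    using ex_max_vimage[OF bruhat_le_inv[OF assms] img[OF p(1)]] by blast
  have m_perm: "m permutes {1..n}" using m bruhat_le_permutes by blast
  have "bruhat_le n (inv m) \<nu>" by (rule inv_le[OF m(1) p(2)])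
  moreover have "inv m ` {..k} = \<sigma> ` {..k}"
    using m(2) img[OF permutes_inv[OF m_perm]] inv_inv[OF m_perm] by simp
  moreover have "bruhat_le n \<tau> (inv m)" if "bruhat_le n \<tau> \<nu>" "\<tau> ` {..k} = \<sigma> ` {..k}" for \<tau>
  proof -
    have \<tau>: "\<tau> permutes {1..n}" using that bruhat_le_permutes by blast
    have "bruhat_le n (inv \<tau>) m"
      using max bruhat_le_inv[OF that(1)] img[OF \<tau>] that(2) by simp
    then show ?thesis using bruhat_le_inv inv_inv[OF \<tau>] by metis
  qed
  ultimately show ?thesis by blast
qed

section \<open>The sets I(\<sigma>) and their behavior under s_i\<close>

text \<open>This is I(\<sigma>), a fiber of the map from \<nu> to the greatest element below \<nu>
  in the given coset. That element is described by its property instead of being chosen.\<close>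

definition coset_fiber :: "nat \<Rightarrow> nat \<Rightarrow> (nat \<Rightarrow> nat) \<Rightarrow> (nat \<Rightarrow> nat) set" where
  "coset_fiber n k \<sigma> = {\<nu>. bruhat_le n \<sigma> \<nu> \<and>
     (\<forall>\<tau>. bruhat_le n \<tau> \<nu> \<and> \<tau> ` {..k} = \<sigma> ` {..k} \<longrightarrow> bruhat_le n \<tau> \<sigma>)}"

text \<open>The lower bound comes from the interval, and the maximality condition passes from \<nu>
  to everything below it.\<close>

lemma coset_fiber_interval:
  "\<nu> \<in> coset_fiber n k \<sigma> \<Longrightarrow> \<nu>' \<in> bruhat_interval n \<sigma> \<nu> \<Longrightarrow> \<nu>' \<in> coset_fiber n k \<sigma>"
  unfolding coset_fiber_def bruhat_interval_def by (blast intro: bruhat_le_trans)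

text \<open>If \<tau> \<le> \<mu> s_i lies in the coset, then \<open>low i \<tau>\<close> is below
  \<mu>, hence below \<sigma>, and \<open>high i\<close> lifts this to \<tau> \<le> \<sigma>. So a
  member of I(\<sigma>) ascending at i has a partner to cancel with.\<close>

lemma coset_fiber_ascent:
  assumes "\<mu> \<in> coset_fiber n k \<sigma>" "1 \<le> i" "i < n" "i \<noteq> k" "\<sigma> (Suc i) < \<sigma> i" "\<mu> i < \<mu> (Suc i)"
  shows "\<mu> \<circ> simple_refl i \<in> coset_fiber n k \<sigma>"
proof -
  have le: "bruhat_le n \<sigma> \<mu>"
    and max: "\<And>\<tau>. bruhat_le n \<tau> \<mu> \<Longrightarrow> \<tau> ` {..k} = \<sigma> ` {..k} \<Longrightarrow> bruhat_le n \<tau> \<sigma>"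
    using assms(1) by (auto simp: coset_fiber_def)
  note p = bruhat_le_permutes[OF le]
  have "bruhat_le n \<sigma> (\<mu> \<circ> simple_refl i)"
    using bruhat_le_trans[OF le bruhat_le_simple_refl[OF p(2)]] assms by blast
  moreover have "bruhat_le n \<tau> \<sigma>"
    if \<tau>: "bruhat_le n \<tau> (\<mu> \<circ> simple_refl i)" "\<tau> ` {..k} = \<sigma> ` {..k}" for \<tau>
  proof -
    have perm: "\<tau> permutes {1..n}" using \<tau> bruhat_le_permutes by blast
    have "bruhat_le n (low i \<tau>) \<mu>"
      using bruhat_le_low[OF \<tau>(1) assms(2,3)] assms(6) by (simp add: low_def[of i "_ \<circ> _"])
    moreover have "low i \<tau> ` {..k} = \<sigma> ` {..k}"
      using coset_low[OF assms(4)] \<tau>(2) by simp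
    ultimately have "bruhat_le n (high i (low i \<tau>)) (high i \<sigma>)"
      using max bruhat_le_high[OF _ assms(2,3)] by blast
    moreover have "high i (low i \<tau>) = high i \<tau>" "high i \<sigma> = \<sigma>"
      using permutes_neq_Suc[OF perm, of i] assms(5) by (simp_all add: high_def low_def)
    ultimately show ?thesis
      using le_high[OF perm assms(2,3)] bruhat_le_trans by metis
  qed
  ultimately show ?thesis by (simp add: coset_fiber_def)
qed

text \<open>The right-hand side describes the terms that survive \<pi>_i. That they fill I(\<sigma>
  s_i) rests on the existence of greatest elements in cosets.\<close>

lemma coset_fiber_simple_refl:
  assumes \<sigma>: "\<sigma> permutes {1..n}" and i: "1 \<le> i" "i < n" "i \<noteq> k" and desc: "\<sigma> (Suc i) < \<sigma> i"
  shows "\<mu> \<in> coset_fiber n k (\<sigma> \<circ> simple_refl i) \<longleftrightarrow>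
    \<mu> i < \<mu> (Suc i) \<and> \<mu> \<circ> simple_refl i \<in> coset_fiber n k \<sigma> \<and> \<mu> \<notin> coset_fiber n k \<sigma>"
    (is "?L \<longleftrightarrow> ?R")
proof -
  let ?s = "simple_refl i"
  note coset = coset_simple_refl[OF i(3), of \<sigma>]
  have \<sigma>s: "\<sigma> \<circ> ?s permutes {1..n}" by (rule permutes_comp_simple_refl[OF \<sigma> i(1,2)])
  have le: "bruhat_le n (\<sigma> \<circ> ?s) \<sigma>"
    using bruhat_le_simple_refl[OF \<sigma>s i(1,2)] desc by simp
  have high: "high i (\<sigma> \<circ> ?s) = \<sigma>" and low: "low i \<sigma> = \<sigma> \<circ> ?s"
    using desc by (simp_all add: high_def low_def)
  have len: "perm_length n \<sigma> = Suc (perm_length n (\<sigma> \<circ> ?s))"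
    using card_inversions_simple_refl[of i n "\<sigma> \<circ> ?s"] i desc
    by (simp add: perm_length_eq_card_inversions \<sigma> \<sigma>s)
  show ?thesis
  proof
    assume ?L
    then have ge: "bruhat_le n (\<sigma> \<circ> ?s) \<mu>"
      and max: "\<And>\<tau>. bruhat_le n \<tau> \<mu> \<Longrightarrow> \<tau> ` {..k} = \<sigma> ` {..k} \<Longrightarrow> bruhat_le n \<tau> (\<sigma> \<circ> ?s)"
      unfolding coset_fiber_def coset by auto
    have \<mu>: "\<mu> permutes {1..n}" by (rule bruhat_le_permutes[OF ge])
    have not_le: "\<not> bruhat_le n \<sigma> \<mu>"
      using max[of \<sigma>] le bruhat_le_antisym len by (metis n_not_Suc_n)
    have ge': "bruhat_le n \<sigma> (high i \<mu>)"
      using bruhat_le_high[OF ge i(1,2)] high by simp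
    \<comment> \<open>At a descent \<open>high i \<mu>\<close> would be \<mu> itself, against
      \<open>not_le\<close>.\<close>
    then have asc: "\<mu> i < \<mu> (Suc i)" using not_le by (auto simp: high_def split: if_splits)
    have "bruhat_le n \<tau> \<sigma>" if \<tau>: "bruhat_le n \<tau> (\<mu> \<circ> ?s)" "\<tau> ` {..k} = \<sigma> ` {..k}" for \<tau>
    proof -
      have perm: "\<tau> permutes {1..n}" using \<tau> bruhat_le_permutes by blast
      have "bruhat_le n (low i \<tau>) \<mu>"
        using bruhat_le_low[OF \<tau>(1) i(1,2)] asc by (simp add: low_def[of i "_ \<circ> _"])
      moreover have "low i \<tau> ` {..k} = \<sigma> ` {..k}"
        using coset_low[OF i(3)] \<tau>(2) by simp
      ultimately have "bruhat_le n (high i (low i \<tau>)) \<sigma>"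
        using bruhat_le_high[OF max i(1,2)] high by metis
      moreover have "high i (low i \<tau>) = high i \<tau>"
        using permutes_neq_Suc[OF perm, of i] by (simp add: high_def low_def)
      ultimately show ?thesis using le_high[OF perm i(1,2)] bruhat_le_trans by metis
    qed
    then show ?R using asc ge' not_le by (auto simp: coset_fiber_def high_def)
  next
    assume R: ?R
    then have asc: "\<mu> i < \<mu> (Suc i)" and ge: "bruhat_le n \<sigma> (\<mu> \<circ> ?s)"
      and max: "\<And>\<tau>. bruhat_le n \<tau> (\<mu> \<circ> ?s) \<Longrightarrow> \<tau> ` {..k} = \<sigma> ` {..k} \<Longrightarrow> bruhat_le n \<tau> \<sigma>"
      by (auto simp: coset_fiber_def)
    have "\<mu> \<circ> ?s permutes {1..n}" by (rule bruhat_le_permutes[OF ge])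
    then have \<mu>: "\<mu> permutes {1..n}" using permutes_comp_simple_refl[OF _ i(1,2)] by fastforce
    have le_s: "bruhat_le n \<mu> (\<mu> \<circ> ?s)" by (rule bruhat_le_simple_refl[OF \<mu> i(1,2) asc])
    have ge': "bruhat_le n (\<sigma> \<circ> ?s) \<mu>"
      using bruhat_le_low[OF ge i(1,2)] asc low by (simp add: low_def[of i "\<mu> \<circ> _"])
    obtain m where m: "bruhat_le n m \<mu>" "m ` {..k} = \<sigma> ` {..k}"
      and m_max: "\<And>\<tau>. bruhat_le n \<tau> \<mu> \<Longrightarrow> \<tau> ` {..k} = \<sigma> ` {..k} \<Longrightarrow> bruhat_le n \<tau> m"
      using ex_coset_max[OF ge', of k] unfolding coset by blast
    have "bruhat_le n m \<sigma>" using max m le_s bruhat_le_trans by blast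
    \<comment> \<open>If m were \<sigma>, then \<mu> would belong to I(\<sigma>). Between \<sigma>
      s_i and \<sigma>, whose lengths differ by one, only m = \<sigma> s_i remains.\<close>
    moreover have "m \<noteq> \<sigma>"
      using R m m_max by (auto simp: coset_fiber_def)
    ultimately have "perm_length n m < perm_length n \<sigma>"
      using bruhat_le_eq_or_length_less by blast
    moreover have "bruhat_le n (\<sigma> \<circ> ?s) m" using m_max[OF ge' coset] .
    ultimately have "m = \<sigma> \<circ> ?s" using bruhat_le_eq_or_length_less len by fastforce
    then show ?L using ge' m_max unfolding coset_fiber_def coset by blast
  qed
qed

section \<open>The longest permutation and the longest element of a coset\<close>

lemma longest_perm_longest_perm [simp]: "longest_perm n \<circ> longest_perm n = id"
  by (auto simp: longest_perm_def fun_eq_iff)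

lemma longest_perm_permutes: "longest_perm n permutes {1..n}"
proof (rule bij_imp_permutes)
  show "bij_betw (longest_perm n) {1..n} {1..n}"
    by (rule bij_betw_byWitness[where f' = "longest_perm n"]) (auto simp: longest_perm_def)
qed (auto simp: longest_perm_def)

lemma longest_perm_less:
  "1 \<le> a \<Longrightarrow> a < b \<Longrightarrow> b \<le> n \<Longrightarrow> longest_perm n b < longest_perm n a"
  by (auto simp: longest_perm_def)

text \<open>Multiplication by s_i at an ascent climbs in the order. The crude bound
  \<open>n * n\<close> on the inversion number makes the measure drop with each climb.\<close>

lemma bruhat_le_longest_perm:
  assumes "\<sigma> permutes {1..n}"
  shows "bruhat_le n \<sigma> (longest_perm n)"
  using assms
proof (induction "n * n - card (inversions n \<sigma>)" arbitrary: \<sigma> rule: less_induct)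
  case less
  show ?case
  proof (cases "\<exists>i. 1 \<le> i \<and> i < n \<and> \<sigma> i < \<sigma> (Suc i)")
    case True
    then obtain i where i: "1 \<le> i" "i < n" "\<sigma> i < \<sigma> (Suc i)" by blast
    have "\<sigma> \<circ> simple_refl i permutes {1..n}"
      by (rule permutes_comp_simple_refl[OF less.prems i(1,2)])
    moreover have "n * n - card (inversions n (\<sigma> \<circ> simple_refl i)) < n * n - card (inversions n \<sigma>)"
      using card_inversions_simple_refl[of i n \<sigma>, OF i]
        card_inversions_le[of n "\<sigma> \<circ> simple_refl i"] by linarith
    ultimately have "bruhat_le n (\<sigma> \<circ> simple_refl i) (longest_perm n)" using less.hyps by blast
    then show ?thesis by (rule bruhat_le_trans[OF bruhat_le_simple_refl[OF less.prems i]])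
  next
    case False
    \<comment> \<open>As \<omega> reverses the order of values, a \<sigma> without ascents makes
      \<omega>\<sigma> free of descents.\<close>
    have "longest_perm n \<circ> \<sigma> = id"
    proof (rule permutes_no_descent_eq_id)
      show "longest_perm n \<circ> \<sigma> permutes {1..n}"
        by (rule permutes_compose[OF less.prems longest_perm_permutes])
      fix i assume "1 \<le> i" "i < n"
      then show "(longest_perm n \<circ> \<sigma>) i \<le> (longest_perm n \<circ> \<sigma>) (Suc i)"
        using False permutes_neq_Suc[OF less.prems, of i] longest_perm_less[of "\<sigma> (Suc i)" "\<sigma> i" n]
          permutes_in_image[OF less.prems, of i] permutes_in_image[OF less.prems, of "Suc i"] by auto
    qed
    then have "longest_perm n \<circ> (longest_perm n \<circ> \<sigma>) = longest_perm n \<circ> id" by (rule arg_cong)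
    then have "\<sigma> = longest_perm n" by (simp only: comp_assoc[symmetric] longest_perm_longest_perm id_comp comp_id)
    then show ?thesis using bruhat_le_refl less.prems by simp
  qed
qed

lemma longest_perm_bruhat_le_iff: "bruhat_le n (longest_perm n) \<nu> \<longleftrightarrow> \<nu> = longest_perm n"
proof
  assume "bruhat_le n (longest_perm n) \<nu>"
  then show "\<nu> = longest_perm n"
    using bruhat_le_longest_perm bruhat_le_permutes(2) bruhat_le_antisym by blast
qed (simp add: bruhat_le_refl longest_perm_permutes)

text \<open>If the images agree, the quotient \<gamma> preserves each of the blocks {1..k} and
  {k+1..n}, and its restrictions to them are the two factors.\<close>

lemma young_coset_iff:
  assumes \<sigma>: "\<sigma> permutes {1..n}" and "k \<le> n"
  shows "\<tau> \<in> young_coset n k \<sigma> \<longleftrightarrow> \<tau> permutes {1..n} \<and> \<tau> ` {..k} = \<sigma> ` {..k}"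
proof
  assume "\<tau> \<in> young_coset n k \<sigma>"
  then obtain \<alpha> \<beta> where \<tau>: "\<tau> = \<sigma> \<circ> (\<alpha> \<circ> \<beta>)"
    and \<alpha>: "\<alpha> permutes {1..k}" and \<beta>: "\<beta> permutes {k+1..n}"
    by (auto simp: young_coset_def)
  have "\<alpha> permutes {1..n}" "\<beta> permutes {1..n}"
    using permutes_subset[OF \<alpha>] permutes_subset[OF \<beta>] \<open>k \<le> n\<close> by auto
  then have "\<tau> permutes {1..n}" unfolding \<tau> using \<sigma> by (intro permutes_compose)
  moreover have "\<alpha> ` {..k} = {..k}" using permutes_image[OF permutes_subset[OF \<alpha>]] by auto
  moreover have "\<beta> ` {..k} = {..k}" using permutes_not_in[OF \<beta>] by force
  ultimately show "\<tau> permutes {1..n} \<and> \<tau> ` {..k} = \<sigma> ` {..k}"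
    unfolding \<tau> by (metis image_comp)
next
  assume R: "\<tau> permutes {1..n} \<and> \<tau> ` {..k} = \<sigma> ` {..k}"
  define \<gamma> where "\<gamma> = inv \<sigma> \<circ> \<tau>"
  have \<gamma>: "\<gamma> permutes {1..n}"
    unfolding \<gamma>_def using R \<sigma> by (intro permutes_compose permutes_inv) auto
  have inj: "inj \<gamma>" using \<gamma> by (rule permutes_inj)
  have "\<gamma> ` {..k} = inv \<sigma> ` \<tau> ` {..k}" by (simp only: \<gamma>_def image_comp)
  also have "\<dots> = inv \<sigma> ` \<sigma> ` {..k}" using R by simp
  also have "\<dots> = {..k}" using \<sigma> by (intro image_inv_f_f permutes_inj)
  finally have "\<gamma> ` {..k} = {..k}" .
  \<comment> \<open>Removing the fixed point 0 turns \<open>{..k}\<close> into the block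
    {1..k}.\<close>
  moreover have "\<gamma> 0 = 0" using permutes_not_in[OF \<gamma>, of 0] by simp
  ultimately have "\<gamma> ` ({..k} - {0}) = {..k} - {0}"
    using image_set_diff[OF inj, of "{..k}" "{0}"] by simp
  moreover have "{..k} - {0} = {1..k}" by auto
  ultimately have low: "\<gamma> ` {1..k} = {1..k}" by simp
  have "\<gamma> ` ({1..n} - {1..k}) = {1..n} - {1..k}"
    using image_set_diff[OF inj, of "{1..n}" "{1..k}"] permutes_image[OF \<gamma>] low by simp
  moreover have "{1..n} - {1..k} = {k+1..n}" by auto
  ultimately have high: "\<gamma> ` {k+1..n} = {k+1..n}" by simp
  define \<alpha> where "\<alpha> = (\<lambda>i. if i \<in> {1..k} then \<gamma> i else i)"
  define \<beta> where "\<beta> = (\<lambda>i. if i \<in> {k+1..n} then \<gamma> i else i)"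
  have "bij_betw \<alpha> {1..k} {1..k} \<longleftrightarrow> bij_betw \<gamma> {1..k} {1..k}"
    by (rule bij_betw_cong) (simp add: \<alpha>_def)
  then have \<alpha>: "\<alpha> permutes {1..k}"
    using inj_on_subset[OF inj] low by (intro bij_imp_permutes) (auto simp: bij_betw_def \<alpha>_def)
  have "bij_betw \<beta> {k+1..n} {k+1..n} \<longleftrightarrow> bij_betw \<gamma> {k+1..n} {k+1..n}"
    by (rule bij_betw_cong) (simp add: \<beta>_def)
  then have \<beta>: "\<beta> permutes {k+1..n}"
    using inj_on_subset[OF inj] high by (intro bij_imp_permutes) (auto simp: bij_betw_def \<beta>_def)
  have "(\<alpha> \<circ> \<beta>) i = \<gamma> i" for i
  proof (cases "i \<in> {k+1..n}")
    case True
    then have "\<gamma> i \<in> {k+1..n}" using high by blast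
    then show ?thesis using True by (simp add: \<alpha>_def \<beta>_def)
  next
    case False
    then show ?thesis using permutes_not_in[OF \<gamma>, of i] by (auto simp: \<alpha>_def \<beta>_def)
  qed
  then have "\<tau> = \<sigma> \<circ> (\<alpha> \<circ> \<beta>)"
    using permutes_inverses(1)[OF \<sigma>] by (simp add: fun_eq_iff \<gamma>_def)
  then show "\<tau> \<in> young_coset n k \<sigma>" using \<alpha> \<beta> by (auto simp: young_coset_def)
qed

text \<open>Everything lies below \<omega>, so the coset has a greatest element; it is above \<zeta>
  but not longer, hence equal to \<zeta>. The maximality condition of the fiber then holds for every
  \<nu>.\<close>

lemma coset_fiber_coset_max:
  assumes \<sigma>: "\<sigma> permutes {1..n}" and "k \<le> n"
    and max: "is_arg_max (perm_length n) (\<lambda>\<tau>. \<tau> \<in> young_coset n k \<sigma>) \<zeta>"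
  shows "coset_fiber n k \<zeta> = {\<nu>. bruhat_le n \<zeta> \<nu>}"
proof -
  have \<zeta>: "\<zeta> permutes {1..n}" "\<zeta> ` {..k} = \<sigma> ` {..k}"
    and not_longer: "\<And>\<tau>. \<tau> permutes {1..n} \<Longrightarrow> \<tau> ` {..k} = \<sigma> ` {..k} \<Longrightarrow>
      \<not> perm_length n \<zeta> < perm_length n \<tau>"
    using max young_coset_iff[OF \<sigma> \<open>k \<le> n\<close>] by (auto simp: is_arg_max_def)
  obtain m where m: "bruhat_le n m (longest_perm n)" "m ` {..k} = \<zeta> ` {..k}"
    and m_max: "\<And>\<tau>. bruhat_le n \<tau> (longest_perm n) \<Longrightarrow> \<tau> ` {..k} = \<zeta> ` {..k} \<Longrightarrow> bruhat_le n \<tau> m"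
    using ex_coset_max[OF bruhat_le_longest_perm[OF \<zeta>(1)], of k] by blast
  have "bruhat_le n \<zeta> m" using m_max bruhat_le_longest_perm \<zeta> by blast
  then have "\<zeta> = m"
    using not_longer[OF bruhat_le_permutes(1)[OF m(1)]] m(2) \<zeta>(2) bruhat_le_eq_or_length_less
    by metis
  then show ?thesis
    using m_max bruhat_le_longest_perm bruhat_le_permutes(1) by (auto simp: coset_fiber_def)
qed

text \<open>Exchanging an increasing pair inside one block would give a longer element of the same
  coset.\<close>

lemma coset_max_decreasing:
  assumes \<sigma>: "\<sigma> permutes {1..n}" and "k \<le> n"
    and max: "is_arg_max (perm_length n) (\<lambda>\<tau>. \<tau> \<in> young_coset n k \<sigma>) \<zeta>"
    and ab: "1 \<le> a" "a < b" "b \<le> n" "a \<le> k \<longleftrightarrow> b \<le> k"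
  shows "\<zeta> b < \<zeta> a"
proof (rule ccontr)
  have \<zeta>: "\<zeta> permutes {1..n}" "\<zeta> ` {..k} = \<sigma> ` {..k}"
    and not_longer: "\<And>\<tau>. \<tau> permutes {1..n} \<Longrightarrow> \<tau> ` {..k} = \<sigma> ` {..k} \<Longrightarrow>
      \<not> perm_length n \<zeta> < perm_length n \<tau>"
    using max young_coset_iff[OF \<sigma> \<open>k \<le> n\<close>] by (auto simp: is_arg_max_def)
  assume "\<not> \<zeta> b < \<zeta> a"
  then have "\<zeta> a < \<zeta> b"
    using ab permutes_inj[OF \<zeta>(1)] by (metis inj_eq less_irrefl linorder_less_linear)
  then have step: "bruhat_step n \<zeta> (\<zeta> \<circ> transpose a b)"
    using bruhat_step_iff[OF \<zeta>(1)] ab by blast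
  have "transpose a b ` {..k} = {..k}" by (rule transpose_image_eq) (use ab in auto)
  then have "(\<zeta> \<circ> transpose a b) ` {..k} = \<sigma> ` {..k}" using \<zeta>(2) by (metis image_comp)
  then show False
    using not_longer bruhat_step_permutes[OF \<zeta>(1) step] step by (auto simp: bruhat_step_def)
qed

section \<open>Coefficients of the operators and alternating sums\<close>

lemma lookup_frag_of: "poly_mapping.lookup (frag_of a) b = (if a = b then 1 else 0)"
  by (simp add: lookup_single when_def)

text \<open>The case \<open>\<mu> i = \<mu> (Suc i)\<close> arises only for basis elements that are not permutations.\<close>

lemma lookup_pi_op:
  "poly_mapping.lookup (pi_op i x) \<mu> =
    (if \<mu> i < \<mu> (Suc i) then poly_mapping.lookup x \<mu> + poly_mapping.lookup x (\<mu> \<circ> simple_refl i)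
     else if \<mu> i = \<mu> (Suc i) then poly_mapping.lookup x \<mu> else 0)"
  using subset_UNIV[of "Poly_Mapping.keys x"]
proof (induction x rule: frag_induction)
  case (one \<sigma>)
  \<comment> \<open>The preimages of \<mu> under \<open>low i\<close> are \<mu> and \<mu> s_i at an
    ascent, and there are none at a descent.\<close>
  have low: "low i \<sigma> = \<mu> \<longleftrightarrow>
    (if \<mu> i < \<mu> (Suc i) then \<sigma> = \<mu> \<or> \<sigma> = \<mu> \<circ> simple_refl i else \<mu> i = \<mu> (Suc i) \<and> \<sigma> = \<mu>)"
  proof (cases "\<sigma> (Suc i) < \<sigma> i")
    case True
    then have "low i \<sigma> = \<mu> \<longleftrightarrow> \<sigma> = \<mu> \<circ> simple_refl i"
      unfolding low_def using simple_refl_comp_self[of \<sigma> i] simple_refl_comp_self[of \<mu> i] by metis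
    moreover have "\<mu> i < \<mu> (Suc i)" if "\<sigma> = \<mu> \<circ> simple_refl i" using True that by simp
    ultimately show ?thesis using True by (metis less_asym less_irrefl)
  qed (auto simp: low_def)
  have pi: "pi_op i (frag_of \<sigma>) = frag_of (low i \<sigma>)"
    unfolding pi_op_def low_def by simp
  have neq: "\<mu> \<noteq> \<mu> \<circ> simple_refl i" if "\<mu> i < \<mu> (Suc i)"
    using that by (metis comp_apply simple_refl_apply(1) less_irrefl)
  show ?case unfolding pi lookup_frag_of low using neq by (smt (verit))
next
  case (diff a b)
  define \<mu>' where "\<mu>' = \<mu> \<circ> simple_refl i"
  have "pi_op i (a - b) = pi_op i a - pi_op i b" by (simp add: pi_op_def frag_extend_diff)
  then show ?case
    using diff unfolding \<mu>'_def[symmetric] by (auto simp: lookup_minus)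
qed (simp add: pi_op_def)

text \<open>The sign is that of the length difference between \<mu> and \<sigma>; the sum of lengths
  has the same parity and avoids truncated subtraction.\<close>

definition is_signed_sum :: "nat \<Rightarrow> (nat \<Rightarrow> nat) \<Rightarrow> (nat \<Rightarrow> nat) set \<Rightarrow> kmod \<Rightarrow> bool" where
  "is_signed_sum n \<sigma> S x \<longleftrightarrow> (\<forall>\<mu>. poly_mapping.lookup x \<mu> =
     (if \<mu> \<in> S then (- 1) ^ (card (inversions n \<mu>) + card (inversions n \<sigma>)) else 0))"

text \<open>The new coefficient at \<mu> is that of x at \<mu> s_i for an ascent, and minus that of
  x at \<mu> for a descent. Both are read off at \<open>high i \<mu>\<close>, which is above
  \<sigma> exactly when \<mu> is above \<sigma> s_i.\<close>

lemma is_signed_sum_pi_hat_op: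
  assumes \<sigma>: "\<sigma> permutes {1..n}" and i: "1 \<le> i" "i < n" and desc: "\<sigma> (Suc i) < \<sigma> i"
    and x: "is_signed_sum n \<sigma> {\<nu>. bruhat_le n \<sigma> \<nu>} x"
  shows "is_signed_sum n (\<sigma> \<circ> simple_refl i) {\<nu>. bruhat_le n (\<sigma> \<circ> simple_refl i) \<nu>} (pi_hat_op i x)"
proof -
  let ?s = "simple_refl i"
  have len: "card (inversions n \<sigma>) = Suc (card (inversions n (\<sigma> \<circ> ?s)))"
    using card_inversions_simple_refl[of i n "\<sigma> \<circ> ?s"] i desc by simp
  have low: "low i \<sigma> = \<sigma> \<circ> ?s" and high: "high i (\<sigma> \<circ> ?s) = \<sigma>"
    using desc by (simp_all add: low_def high_def)
  \<comment> \<open>Here \<mu> is an arbitrary function, so the backward direction first recovers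
    that it is a permutation.\<close>
  have iff: "bruhat_le n (\<sigma> \<circ> ?s) \<mu> \<longleftrightarrow> bruhat_le n \<sigma> (high i \<mu>)" for \<mu>
  proof
    assume "bruhat_le n \<sigma> (high i \<mu>)"
    from bruhat_le_low[OF this i] have le: "bruhat_le n (\<sigma> \<circ> ?s) (low i (high i \<mu>))" by (simp add: low)
    then have eq: "low i (high i \<mu>) = low i \<mu>" and "low i \<mu> permutes {1..n}"
      using bruhat_le_permutes(2)[OF le] by (auto simp: low_def high_def split: if_splits)
    then have \<mu>: "\<mu> permutes {1..n}"
      using permutes_comp_simple_refl[OF _ i, of "\<mu> \<circ> ?s"] by (auto simp: low_def split: if_splits)
    show "bruhat_le n (\<sigma> \<circ> ?s) \<mu>"
      using bruhat_le_trans[OF le] low_le[OF \<mu> i] eq by simp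
  qed (use bruhat_le_high[OF _ i] high in metis)
  show ?thesis
    unfolding is_signed_sum_def
  proof
    fix \<mu> :: "nat \<Rightarrow> nat"
    consider "\<mu> i < \<mu> (Suc i)" | "\<mu> (Suc i) < \<mu> i" | "\<mu> i = \<mu> (Suc i)"
      using linorder_less_linear[of "\<mu> i" "\<mu> (Suc i)"] by blast
    then show "poly_mapping.lookup (pi_hat_op i x) \<mu> =
      (if \<mu> \<in> {\<nu>. bruhat_le n (\<sigma> \<circ> ?s) \<nu>}
       then (- 1) ^ (card (inversions n \<mu>) + card (inversions n (\<sigma> \<circ> ?s))) else 0)"
    proof cases
      case 1
      have "card (inversions n (\<mu> \<circ> ?s)) = Suc (card (inversions n \<mu>))"
        by (rule card_inversions_simple_refl[OF i 1])
      moreover have "high i \<mu> = \<mu> \<circ> ?s" using 1 by (simp add: high_def)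
      ultimately show ?thesis
        using 1 x len iff[of \<mu>] by (simp add: pi_hat_op_def lookup_minus lookup_pi_op is_signed_sum_def)
    next
      case 2
      then have "high i \<mu> = \<mu>" by (simp add: high_def)
      then show ?thesis
        using 2 x len iff[of \<mu>] by (simp add: pi_hat_op_def lookup_minus lookup_pi_op is_signed_sum_def)
    next
      case 3
      then have "\<not> bruhat_le n (\<sigma> \<circ> ?s) \<mu>"
        using permutes_neq_Suc[of \<mu> "{1..n}" i] bruhat_le_permutes(2) by blast
      then show ?thesis
        using 3 by (simp add: pi_hat_op_def lookup_minus lookup_pi_op)
    qed
  qed
qed

text \<open>At an ascent the coefficients of x at \<mu> and \<mu> s_i add up. They cancel if both
  lie in I(\<sigma>); \<mu> alone is excluded by \<open>coset_fiber_ascent\<close>; \<mu> s_i alone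
  means that \<mu> is in I(\<sigma> s_i). At a descent both sides vanish.\<close>

lemma is_signed_sum_pi_op:
  assumes \<sigma>: "\<sigma> permutes {1..n}" and i: "1 \<le> i" "i < n" "i \<noteq> k" and desc: "\<sigma> (Suc i) < \<sigma> i"
    and x: "is_signed_sum n \<sigma> (coset_fiber n k \<sigma>) x"
  shows "is_signed_sum n (\<sigma> \<circ> simple_refl i) (coset_fiber n k (\<sigma> \<circ> simple_refl i)) (pi_op i x)"
  unfolding is_signed_sum_def
proof
  fix \<mu> :: "nat \<Rightarrow> nat"
  let ?s = "simple_refl i"
  have len: "card (inversions n \<sigma>) = Suc (card (inversions n (\<sigma> \<circ> ?s)))"
    using card_inversions_simple_refl[of i n "\<sigma> \<circ> ?s"] i desc by simp
  note iff = coset_fiber_simple_refl[OF \<sigma> i desc, of \<mu>]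
  consider "\<mu> i < \<mu> (Suc i)" | "\<mu> (Suc i) < \<mu> i" | "\<mu> i = \<mu> (Suc i)"
      using linorder_less_linear[of "\<mu> i" "\<mu> (Suc i)"] by blast
  then show "poly_mapping.lookup (pi_op i x) \<mu> =
      (if \<mu> \<in> coset_fiber n k (\<sigma> \<circ> ?s)
       then (- 1) ^ (card (inversions n \<mu>) + card (inversions n (\<sigma> \<circ> ?s))) else 0)"
  proof cases
    case 1
    have "card (inversions n (\<mu> \<circ> ?s)) = Suc (card (inversions n \<mu>))"
      by (rule card_inversions_simple_refl[OF i(1,2) 1])
    then show ?thesis
      using 1 x len iff coset_fiber_ascent[OF _ i desc 1] by (auto simp: lookup_pi_op is_signed_sum_def)
  next
    case 2
    then show ?thesis using iff by (simp add: lookup_pi_op)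
  next
    case 3
    then have "\<mu> \<notin> coset_fiber n k \<sigma>"
      using permutes_neq_Suc[of \<mu> "{1..n}" i] bruhat_le_permutes(2) by (auto simp: coset_fiber_def)
    then show ?thesis
      using 3 x iff by (simp add: lookup_pi_op is_signed_sum_def)
  qed
qed

lemma is_signed_sum_pi_hat_word:
  assumes "reduced_decomposition n (word_prod w) w"
  defines "\<zeta> \<equiv> longest_perm n \<circ> word_prod w"
  shows "is_signed_sum n \<zeta> {\<nu>. bruhat_le n \<zeta> \<nu>} (pi_hat_word w (frag_of (longest_perm n)))"
  using assms(1) unfolding \<zeta>_def
proof (induction w rule: rev_induct)
  \<comment> \<open>Only \<omega> is above \<omega>, and the exponent of its sign is twice its
    length.\<close>
  case Nil
  show ?case
    by (simp add: pi_hat_word_def is_signed_sum_def lookup_frag_of longest_perm_bruhat_le_iff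
        flip: mult_2)
next
  case (snoc i w)
  note red = reduced_decomposition_snoc[OF snoc.prems]
  let ?p = "word_prod w"
  have p: "?p permutes {1..n}"
    using red(1) by (intro word_prod_permutes) (simp add: reduced_decomposition_iff)
  \<comment> \<open>Reducedness gives an ascent of the prefix product, which \<omega> turns into a
    descent.\<close>
  have "longest_perm n (?p (Suc i)) < longest_perm n (?p i)"
    using red(3-5) permutes_in_image[OF p, of i] permutes_in_image[OF p, of "Suc i"]
    by (intro longest_perm_less) auto
  then have desc: "(longest_perm n \<circ> ?p) (Suc i) < (longest_perm n \<circ> ?p) i" by simp
  have word: "pi_hat_word (w @ [i]) y = pi_hat_op i (pi_hat_word w y)" for y
    by (simp add: pi_hat_word_def)
  show ?case
    unfolding word red(2) comp_assoc[symmetric]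
    by (rule is_signed_sum_pi_hat_op[OF permutes_compose[OF p longest_perm_permutes] red(3,4) desc
          snoc.IH[OF red(1)]])
qed

text \<open>A reduced word of an element of W_J has no letter k, so each letter takes the running
  permutation one step down inside the coset of \<zeta>.\<close>

lemma is_signed_sum_pi_word:
  assumes \<zeta>: "\<zeta> permutes {1..n}"
    and decreasing: "\<And>a b. 1 \<le> a \<Longrightarrow> a < b \<Longrightarrow> b \<le> n \<Longrightarrow> a \<le> k \<longleftrightarrow> b \<le> k \<Longrightarrow> \<zeta> b < \<zeta> a"
    and x: "is_signed_sum n \<zeta> (coset_fiber n k \<zeta>) x"
    and "reduced_decomposition n (word_prod w) w" "word_prod w ` {..k} = {..k}"
  shows "is_signed_sum n (\<zeta> \<circ> word_prod w) (coset_fiber n k (\<zeta> \<circ> word_prod w)) (pi_word w x)"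
  using assms(4,5)
proof (induction w rule: rev_induct)
  case Nil
  then show ?case using x by (simp add: pi_word_def)
next
  case (snoc i w)
  note red = reduced_decomposition_snoc[OF snoc.prems(1)]
  let ?p = "word_prod w"
  have p: "?p permutes {1..n}"
    using red(1) by (intro word_prod_permutes) (simp add: reduced_decomposition_iff)
  have inj: "inj ?p" using p by (rule permutes_inj)
  have image: "(?p \<circ> simple_refl i) ` {..k} = {..k}" using snoc.prems(2) unfolding red(2) .
  \<comment> \<open>If the last letter were k, stability of \<open>{..k}\<close> would give p(k+1)
    \<le> k for the prefix product p, and the ascent p(k) < k. But the whole product takes the value
    p(k) at position k + 1, outside \<open>{..k}\<close>.\<close>
  have "i \<noteq> k"
  proof
    assume "i = k"
    then have "(?p \<circ> simple_refl i) i \<in> {..k}" using image by blast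
    then have "?p i \<in> (?p \<circ> simple_refl i) ` {..k}" unfolding image using red(5) by simp
    then obtain j where "j \<le> k" "?p i = ?p (simple_refl i j)" by auto
    then have "j \<le> k" "i = simple_refl i j" using inj by (auto simp: inj_eq)
    then show False using \<open>i = k\<close> by (auto simp: simple_refl_def transpose_def split: if_splits)
  qed
  have stable: "?p ` {..k} = {..k}"
    by (rule trans[OF coset_simple_refl[OF \<open>i \<noteq> k\<close>, symmetric] image])
  have block: "?p j \<le> k \<longleftrightarrow> j \<le> k" for j
    using inj_image_mem_iff[OF inj, of j "{..k}"] unfolding stable by simp
  \<comment> \<open>The prefix product preserves the blocks and ascends at i, while \<zeta>
    decreases on each block.\<close>
  have "\<zeta> (?p (Suc i)) < \<zeta> (?p i)"
  proof (rule decreasing)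
    show "1 \<le> ?p i" "?p (Suc i) \<le> n"
      using permutes_in_image[OF p, of i] permutes_in_image[OF p, of "Suc i"] red(3,4) by simp_all
    show "?p i \<le> k \<longleftrightarrow> ?p (Suc i) \<le> k" unfolding block using \<open>i \<noteq> k\<close> by linarith
  qed (rule red(5))
  then have desc: "(\<zeta> \<circ> ?p) (Suc i) < (\<zeta> \<circ> ?p) i" by simp
  have word: "pi_word (w @ [i]) y = pi_op i (pi_word w y)" for y by (simp add: pi_word_def)
  show ?case
    unfolding word red(2) comp_assoc[symmetric]
    by (rule is_signed_sum_pi_op[OF permutes_compose[OF p \<zeta>] red(3,4) \<open>i \<noteq> k\<close> desc
          snoc.IH[OF red(1) stable]])
qed

section \<open>The support of the expansion and its convexity\<close>

theorem corollary3p3: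
  fixes n k :: nat and \<sigma> \<zeta> \<nu> \<nu>' :: "nat \<Rightarrow> nat" and u v :: "nat list"
  assumes "\<sigma> permutes {1..n}"
    and "1 \<le> k" and "k < n"
    and "is_arg_max (perm_length n) (\<lambda>\<tau>. \<tau> \<in> young_coset n k \<sigma>) \<zeta>"
    and "reduced_decomposition n (longest_perm n \<circ> \<zeta>) u"
    and "reduced_decomposition n (inv \<zeta> \<circ> \<sigma>) v"
    and "\<nu> \<in> Poly_Mapping.keys (pi_word v (pi_hat_word u (frag_of (longest_perm n))))"
    and "\<nu>' \<in> bruhat_interval n \<sigma> \<nu>"
  shows "\<nu>' \<in> Poly_Mapping.keys (pi_word v (pi_hat_word u (frag_of (longest_perm n))))"
proof -
  have kn: "k \<le> n" using assms(3) by simp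
  have \<zeta>: "\<zeta> permutes {1..n}" "\<zeta> ` {..k} = \<sigma> ` {..k}"
    using assms(4) young_coset_iff[OF assms(1) kn] by (auto simp: is_arg_max_def)
  have u: "word_prod u = longest_perm n \<circ> \<zeta>" and v: "word_prod v = inv \<zeta> \<circ> \<sigma>"
    using assms(5,6) by (simp_all add: reduced_decomposition_iff)
  have "longest_perm n \<circ> word_prod u = \<zeta>"
    by (simp only: u comp_assoc[symmetric] longest_perm_longest_perm id_comp)
  \<comment> \<open>The two kinds of operators meet at \<zeta>, where the support of the hatted
    expansion is I(\<zeta>).\<close>
  then have base: "is_signed_sum n \<zeta> (coset_fiber n k \<zeta>) (pi_hat_word u (frag_of (longest_perm n)))"
    using is_signed_sum_pi_hat_word[of n u] assms(5) u coset_fiber_coset_max[OF assms(1) kn assms(4)]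
    by simp
  \<comment> \<open>As \<zeta> and \<sigma> share their coset, the second word represents an element
    of W_J.\<close>
  have "inv \<zeta> ` \<sigma> ` {..k} = {..k}"
    using \<zeta> by (metis image_inv_f_f permutes_inj)
  then have stable: "word_prod v ` {..k} = {..k}" unfolding v by (metis image_comp)
  have eq: "\<zeta> \<circ> word_prod v = \<sigma>"
    unfolding v using permutes_inverses(1)[OF \<zeta>(1)] by (simp add: fun_eq_iff)
  have "is_signed_sum n (\<zeta> \<circ> word_prod v) (coset_fiber n k (\<zeta> \<circ> word_prod v))
      (pi_word v (pi_hat_word u (frag_of (longest_perm n))))"
  proof (rule is_signed_sum_pi_word[OF \<zeta>(1) _ base _ stable])
    show "reduced_decomposition n (word_prod v) v" using assms(6) by (simp only: v)
  qed (rule coset_max_decreasing[OF assms(1) kn assms(4)])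
  \<comment> \<open>Each coefficient on the fiber is 1 or -1, so the support is the whole
    fiber.\<close>
  then have keys: "Poly_Mapping.keys (pi_word v (pi_hat_word u (frag_of (longest_perm n)))) = coset_fiber n k \<sigma>"
    unfolding eq by (auto simp: is_signed_sum_def in_keys_iff split: if_splits)
  show ?thesis
    using assms(7,8) unfolding keys by (rule coset_fiber_interval)
qed

end
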